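(* Let $X$ be a coded system that has a relatively prime generator, i.e. a generator $\mathcal{W}$ with $\gcd\{|w|: w\in\mathcal{W}\}=1$. Then $(X,\sigma)$ has strong property $P$.
   Context: Let $A$ be a finite alphabet and give $A^{\mathbb{Z}}$ the product topology of the discrete topology on $A$. The shift map is $\sigma((a_i)_{i\in\mathbb{Z}})=(a_{i+1})_{i\in\mathbb{Z}}$. A subshift is a nonempty closed $\sigma$-invariant subset $X\subseteq A^{\mathbb{Z}}$, with $\sigma$ restricted to it. Its language $\mathcal{L}(X)$ is the set of finite words occurring as consecutive entries in some point of $X$. Coded system: a subshift $X$ is coded if there is a countable set $\mathcal{W}$ of (nonempty) finite words over $A$, called a generator of $X$, such that $X$ is the closure of the set of all bi-infinite sequences obtained by concatenating elements of $\mathcal{W}$ in arbitrary order (with arbitrary position of the origin). Equivalently, $\mathcal{L}(X)$ is the set of all subwords of finite concatenations of elements of $\mathcal{W}$. Here $|w|$ denotes the length of the word $w$. Strong property $P$: for a compact metric space $X$ and a homeomorphism $T:X\to X$, the system $(X,T)$ has strong property $P$ if for any finite list of nonempty open sets $U_1,\ldots,U_n$ in $X$ there exists $N\in\mathbb{N}$ (a positive integer) such that for every $k\ge 2$ and every $s=(s(1),\ldots,s(k))\in\{1,\ldots,n\}^k$ there exists $x\in X$ with $$x\in U_{s(1)}\cap T^{-N}U_{s(2)}\cap\cdots\cap T^{-(k-1)N}U_{s(k)}.$$ *)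

theory Defs
  imports "HOL-Analysis.Analysis"
begin

definition full_shift :: "'a set \<Rightarrow> (int \<Rightarrow> 'a) topology" where
  "full_shift A = product_topology (\<lambda>_. discrete_topology A) UNIV"

definition shift :: "(int \<Rightarrow> 'a) \<Rightarrow> (int \<Rightarrow> 'a)" where
  "shift x = (\<lambda>i. x (i + 1))"

text \<open>Invariance means \<open>shift ` X = X\<close>, so that the shift restricts to a homeomorphism of \<open>X\<close>.\<close>

definition subshift :: "'a set \<Rightarrow> (int \<Rightarrow> 'a) set \<Rightarrow> bool" where
  "subshift A X \<longleftrightarrow> X \<noteq> {} \<and> closedin (full_shift A) X \<and> shift ` X = X"

text \<open>The word \<open>w i\<close> occupies the positions from \<open>c i\<close> up to (excluding) \<open>c (i + 1)\<close>. As long as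
  \<open>W\<close> does not contain the empty word, these blocks cover all integers, and since \<open>c 0\<close> is
  unconstrained, the position of the origin is arbitrary.\<close>

definition bi_infinite_concatenations :: "'a list set \<Rightarrow> (int \<Rightarrow> 'a) set" where
  "bi_infinite_concatenations W =
     {x. \<exists>(w :: int \<Rightarrow> 'a list) (c :: int \<Rightarrow> int). \<forall>i.
           w i \<in> W \<and> c (i + 1) = c i + int (length (w i)) \<and>
           (\<forall>j < length (w i). x (c i + int j) = w i ! j)}"

definition is_generator :: "'a set \<Rightarrow> (int \<Rightarrow> 'a) set \<Rightarrow> 'a list set \<Rightarrow> bool" where
  "is_generator A X W \<longleftrightarrow> countable W \<and> W \<subseteq> lists A \<and> [] \<notin> W \<and>
     X = full_shift A closure_of bi_infinite_concatenations W"

definition coded_system :: "'a set \<Rightarrow> (int \<Rightarrow> 'a) set \<Rightarrow> bool" where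
  "coded_system A X \<longleftrightarrow> subshift A X \<and> (\<exists>W. is_generator A X W)"

definition relatively_prime :: "'a list set \<Rightarrow> bool" where
  "relatively_prime W \<longleftrightarrow> Gcd (length ` W) = 1"

text \<open>This is meant for compact metrizable \<open>X\<close> and a homeomorphism \<open>T\<close> of \<open>X\<close>; only the
  topology of \<open>X\<close> enters. The condition \<open>x \<in> T\<^sup>-\<^sup>m U\<close> is expressed as \<open>(T ^^ m) x \<in> U\<close>.\<close>

definition strong_property_P :: "'b topology \<Rightarrow> ('b \<Rightarrow> 'b) \<Rightarrow> bool" where
  "strong_property_P X T \<longleftrightarrow>
     (\<forall>(n::nat) (U :: nat \<Rightarrow> 'b set).
        (\<forall>i\<in>{1..n}. openin X (U i) \<and> U i \<noteq> {}) \<longrightarrow>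
        (\<exists>N::nat. N > 0 \<and>
           (\<forall>k\<ge>2. \<forall>s\<in>{1..k} \<rightarrow> {1..n}.
              \<exists>x\<in>topspace X. \<forall>j\<in>{1..k}. (T ^^ ((j - 1) * N)) x \<in> U (s j))))"

text \<open>Subshifts over a finite alphabet do satisfy the standing assumptions of the previous
  definition.\<close>

lemma topspace_full_shift: "topspace (full_shift A) = UNIV \<rightarrow>\<^sub>E A"
  by (simp add: full_shift_def)

lemma compact_space_full_shift: "finite A \<Longrightarrow> compact_space (full_shift A)"
  by (simp add: full_shift_def compact_space_product_topology compact_space_discrete_topology)

lemma metrizable_space_full_shift: "metrizable_space (full_shift A)"
  by (auto simp: full_shift_def metrizable_space_product_topology
      intro: metrizable_space_discrete_topology)

lemma homeomorphic_map_shift: "homeomorphic_map (full_shift A) (full_shift A) shift"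
proof -
  have c: "continuous_map (full_shift A) (full_shift A) (\<lambda>x i. x (i + k))" for k :: int
    unfolding full_shift_def
    by (auto simp: continuous_map_componentwise_UNIV intro: continuous_map_product_projection)
  have "homeomorphic_maps (full_shift A) (full_shift A) shift (\<lambda>x i. x (i + (-1)))"
    unfolding homeomorphic_maps_def using c[of 1] c[of "-1"] by (auto simp: shift_def[abs_def])
  then show ?thesis
    using homeomorphic_map_maps by blast
qed

lemma subshift_system:
  assumes "finite A" and "subshift A X"
  defines "\<X> \<equiv> subtopology (full_shift A) X"
  shows "topspace \<X> = X" and "compact_space \<X>" and "metrizable_space \<X>"
    and "homeomorphic_map \<X> \<X> shift"
proof -
  have cl: "closedin (full_shift A) X" and inv: "shift ` X = X"
    using assms by (auto simp: subshift_def)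
  show t: "topspace \<X> = X"
    using closedin_subset[OF cl] by (auto simp: \<X>_def topspace_subtopology)
  show "compact_space \<X>"
    using closedin_compact_space[OF compact_space_full_shift[OF assms(1)] cl]
    by (simp add: \<X>_def compact_space_subtopology)
  show "metrizable_space \<X>"
    by (simp add: \<X>_def metrizable_space_subtopology metrizable_space_full_shift)
  show "homeomorphic_map \<X> \<X> shift"
    unfolding \<X>_def using homeomorphic_map_shift[of A] inv closedin_subset[OF cl]
    by (intro homeomorphic_map_subtopologies) (auto simp: Int_absorb1)
qed

end

theory Submission
  imports Defs
begin

text \<open>Each of the given open sets contains a cylinder around a concatenation of generator words, and
  that cylinder can be taken along a finite concatenation \<open>u\<close> of generator words. As the generator
  is relatively prime, all sufficiently large numbers are lengths of such finite concatenations, so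
  the words \<open>u\<close> for the finitely many open sets can be padded on both sides until they have a
  common length \<open>N\<close> and the origin sits at a common position. The padded words can then be
  concatenated in any order, and the periodic repetition of the result lies in the system.\<close>

section \<open>Numerical semigroups with greatest common divisor 1\<close>

text \<open>The least positive difference \<open>d\<close> of two elements of \<open>S\<close>
  divides every element, so it is 1. Then \<open>S\<close> contains some \<open>b\<close> and
  \<open>b + 1\<close>, and sums of these two reach every number from \<open>b * b\<close>
  on.\<close>

lemma numerical_semigroup_cofinite:
  fixes S :: "nat set"
  assumes zero: "0 \<in> S" and add: "\<And>a b. a \<in> S \<Longrightarrow> b \<in> S \<Longrightarrow> a + b \<in> S" and gcd: "Gcd S = 1"
  shows "\<exists>L. \<forall>n\<ge>L. n \<in> S"
proof -
  have mult: "k * a \<in> S" if "a \<in> S" for a k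
    using that by (induction k) (auto intro: zero add)
  define D where "D d \<longleftrightarrow> d > 0 \<and> (\<exists>b\<in>S. b + d \<in> S)" for d
  have "\<not> S \<subseteq> {0}"
    using gcd Gcd_0_iff[of S] by auto
  then obtain e where "e \<in> S" "e > 0"
    by auto
  then have "D e"
    unfolding D_def using zero by (metis add_0)
  define d where "d = (LEAST d. D d)"
  have "D d"
    unfolding d_def using \<open>D e\<close> by (rule LeastI)
  then obtain b where b: "b \<in> S" "b + d \<in> S" and d: "d > 0"
    by (auto simp: D_def)
  have "d dvd s" if "s \<in> S" for s
  proof (rule ccontr)
    assume "\<not> d dvd s"
    then have "s mod d > 0"
      by (simp add: dvd_eq_mod_eq_0)
    \<comment> \<open>Both \<open>s + s div d * b\<close> and \<open>s div d * (b + d)\<close> lie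
      in \<open>S\<close>. Their difference \<open>s mod d\<close> is positive and smaller than
      \<open>d\<close>, against the minimality of \<open>d\<close>.\<close>
    moreover have "s div d * (b + d) + s mod d = s + s div d * b"
      using div_mult_mod_eq[of s d] by (simp add: add_mult_distrib2)
    then have "s div d * (b + d) + s mod d \<in> S"
      using add[OF that mult[OF b(1)]] by simp
    ultimately have "D (s mod d)"
      using mult[OF b(2)] by (auto simp: D_def)
    then have "d \<le> s mod d"
      unfolding d_def by (rule Least_le)
    then show False
      using mod_less_divisor[OF d, of s] by simp
  qed
  then have "d = 1"
    using gcd by (metis Gcd_greatest nat_dvd_1_iff_1)
  have "n \<in> S" if "n \<ge> b * b" for n
  proof (cases "b = 0")
    case True
    then show ?thesis
      using mult[OF b(2), of n] \<open>d = 1\<close> by simp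
  next
    case False
    \<comment> \<open>The remainder is produced by taking \<open>n mod b\<close> copies of
      \<open>b + 1\<close> in place of \<open>b\<close>. At least that many of the
      \<open>n div b\<close> summands must be available, and \<open>n \<ge> b * b\<close> ensures
      this.\<close>
    have "n mod b \<le> n div b"
      using div_le_mono[OF that, of b] False mod_less_divisor[of b n] by fastforce
    then have "n = (n div b - n mod b) * b + n mod b * (b + d)"
      using \<open>d = 1\<close> by (simp add: diff_mult_distrib algebra_simps)
    then show ?thesis
      using add[OF mult[OF b(1)] mult[OF b(2)]] by metis
  qed
  then show ?thesis
    by blast
qed

section \<open>The monoid generated by the words, and its lengths\<close>

definition finite_concatenations :: "'a list set \<Rightarrow> 'a list set" where
  "finite_concatenations W = concat ` lists W"

lemma finite_concatenations_Nil: "[] \<in> finite_concatenations W"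
  by (auto simp: finite_concatenations_def intro: image_eqI[of _ _ "[]"])

lemma finite_concatenations_append:
  assumes "u \<in> finite_concatenations W" "v \<in> finite_concatenations W"
  shows "u @ v \<in> finite_concatenations W"
proof -
  obtain us vs where "us \<in> lists W" "u = concat us" "vs \<in> lists W" "v = concat vs"
    using assms by (auto simp: finite_concatenations_def)
  then have "us @ vs \<in> lists W" "u @ v = concat (us @ vs)"
    by auto
  then show ?thesis
    unfolding finite_concatenations_def by (rule rev_image_eqI)
qed

lemma finite_concatenations_concat:
  assumes "\<And>v. v \<in> set vs \<Longrightarrow> v \<in> finite_concatenations W"
  shows "concat vs \<in> finite_concatenations W"
  using assms
  by (induction vs) (auto intro: finite_concatenations_Nil finite_concatenations_append)

lemma finite_concatenations_incl: "W \<subseteq> finite_concatenations W"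
  by (auto simp: finite_concatenations_def intro: image_eqI[of _ _ "[_]"])

lemma finite_concatenations_subset_lists:
  "W \<subseteq> lists A \<Longrightarrow> finite_concatenations W \<subseteq> lists A"
  by (fastforce simp: finite_concatenations_def)

text \<open>The lengths form an additive semigroup that contains 0 and the lengths of the generator
  words, so its gcd is 1 as well.\<close>

lemma finite_concatenations_lengths:
  assumes "relatively_prime W"
  shows "\<exists>L. \<forall>n\<ge>L. \<exists>u\<in>finite_concatenations W. length u = n"
proof -
  let ?S = "length ` finite_concatenations W"
  have "Gcd ?S dvd Gcd (length ` W)"
    using finite_concatenations_incl[of W] by (intro Gcd_greatest) (auto intro: Gcd_dvd)
  then have "Gcd ?S = 1"
    using assms by (simp add: relatively_prime_def)
  moreover have "0 \<in> ?S"
    using finite_concatenations_Nil[of W] by force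
  moreover have "a + b \<in> ?S" if "a \<in> ?S" "b \<in> ?S" for a b
    using that finite_concatenations_append[of _ W] by (auto simp flip: length_append)
  ultimately obtain L where "\<forall>n\<ge>L. n \<in> ?S"
    using numerical_semigroup_cofinite[of ?S] by blast
  then show ?thesis
    by (metis imageE)
qed

section \<open>Positions of blocks inside a concatenation\<close>

lemma nth_concat_uniform:
  assumes "\<And>i. i < k \<Longrightarrow> length (f i) = N"
  shows "length (concat (map f [0..<k])) = k * N"
    and "i < k \<Longrightarrow> j < N \<Longrightarrow> concat (map f [0..<k]) ! (i * N + j) = f i ! j"
  using assms
proof (induction k)
  case (Suc k)
  {
    case 1
    then show ?case
      using Suc.IH(1) by simp
  next
    case 2
    have len: "length (concat (map f [0..<k])) = k * N"
      using Suc.IH(1) 2 by simp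
    show ?case
    proof (cases "i = k")
      case True
      then show ?thesis
        using len by (simp add: nth_append)
    next
      case False
      then have "i < k"
        using 2 by simp
      then have "Suc i * N \<le> k * N"
        by (intro mult_le_mono1) simp
      then have "i * N + j < k * N"
        using \<open>j < N\<close> by simp
      then show ?thesis
        using Suc.IH(2) 2 \<open>i < k\<close> len by (simp add: nth_append)
    qed
  }
qed simp_all

lemma nth_concat_sum_list:
  assumes "r < length ws" "j < length (ws ! r)"
  shows "concat ws ! (length (concat (take r ws)) + j) = ws ! r ! j"
    and "length (concat (take r ws)) + j < length (concat ws)"
proof -
  have "concat ws = concat (take r ws) @ ws ! r @ concat (drop (Suc r) ws)"
    by (metis assms(1) concat.simps(2) concat_append id_take_nth_drop)
  then show "concat ws ! (length (concat (take r ws)) + j) = ws ! r ! j"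
    and "length (concat (take r ws)) + j < length (concat ws)"
    using assms(2) by (simp_all add: nth_append)
qed

section \<open>Periodic points\<close>

text \<open>A factorisation \<open>ws\<close> of \<open>v\<close> into words of \<open>W\<close>,
  repeated in every period, factors the whole sequence. Block \<open>i\<close> is the factor with
  index \<open>i mod l\<close> in the copy of \<open>v\<close> numbered
  \<open>i div l\<close>.\<close>

lemma periodic_in_bi_infinite_concatenations:
  assumes "v \<in> finite_concatenations W" "v \<noteq> []"
  shows "(\<lambda>t. v ! nat ((t + a) mod int (length v))) \<in> bi_infinite_concatenations W"
proof -
  obtain ws where ws: "ws \<in> lists W" and v: "v = concat ws"
    using assms(1) by (auto simp: finite_concatenations_def)
  define l where "l = int (length ws)"
  have l: "l > 0"
    using assms(2) v by (auto simp: l_def)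
  define r where "r i = nat (i mod l)" for i
  have r: "r i < length ws" for i
    using l pos_mod_bound[of l i] pos_mod_sign[of l i] unfolding r_def l_def by linarith
  define w where "w i = ws ! r i" for i
  \<comment> \<open>The start of block \<open>i\<close>: the full copies of \<open>v\<close> before
    it, then the earlier factors of its own copy. The summand \<open>- a\<close> compensates for
    position \<open>t\<close> reading \<open>v\<close> at \<open>t + a\<close>.\<close>
  define c where
    "c i = i div l * int (length v) + int (length (concat (take (r i) ws))) - a" for i
  have "w i \<in> W" for i
    using ws r by (auto simp: w_def)
  moreover have "c (i + 1) = c i + int (length (w i))" for i
  proof -
    have take: "length (concat (take (Suc (r i)) ws)) =
        length (concat (take (r i) ws)) + length (w i)"
      using r[of i] by (simp add: w_def take_Suc_conv_app_nth)
    show ?thesis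
    \<comment> \<open>After the last factor of a copy the index wraps to 0 and the next copy begins;
      otherwise both blocks lie in the same copy.\<close>
    proof (cases "i mod l = l - 1")
      case True
      then have i: "i + 1 = (i div l + 1) * l"
        using div_mult_mod_eq[of i l] by (simp add: distrib_right)
      have "(i + 1) div l = i div l + 1" "(i + 1) mod l = 0"
        using l unfolding i by simp_all
      moreover have "Suc (r i) = length ws"
        using True l unfolding r_def l_def by linarith
      ultimately show ?thesis
        using take unfolding c_def r_def[of "i + 1"] by (simp add: v distrib_right)
    next
      case False
      have "0 \<le> i mod l" "i mod l < l"
        using l by simp_all
      then have m: "0 \<le> i mod l + 1" "i mod l + 1 < l"
        using False by linarith+
      have "i + 1 = l * (i div l) + (i mod l + 1)"
        by simp
      then have "(i + 1) div l = i div l" "(i + 1) mod l = i mod l + 1"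
        using m by (metis int_div_pos_eq, metis int_mod_pos_eq)
      moreover have "r (i + 1) = Suc (r i)"
        using calculation(2) \<open>0 \<le> i mod l\<close> by (simp add: r_def nat_add_distrib)
      ultimately show ?thesis
        using take by (simp add: c_def)
    qed
  qed
  moreover have "v ! nat ((c i + int j + a) mod int (length v)) = w i ! j"
    if "j < length (w i)" for i j
  proof -
    note n = nth_concat_sum_list[OF r that[unfolded w_def]]
    have "(c i + int j + a) mod int (length v) =
        (int (length (concat (take (r i) ws)) + j) + i div l * int (length v)) mod int (length v)"
      by (simp add: c_def algebra_simps)
    also have "\<dots> = int (length (concat (take (r i) ws)) + j)"
      using n(2) unfolding v mod_mult_self1 by (intro mod_pos_pos_trivial) simp_all
    finally show ?thesis
      using n(1) by (simp only: nat_int v w_def)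
  qed
  ultimately show ?thesis
    unfolding bi_infinite_concatenations_def by blast
qed

section \<open>Finite windows and cylinders\<close>

text \<open>The two claims go through one induction, since locating the letters of the block added
  last uses the length of the blocks before it.\<close>

lemma consecutive_blocks:
  assumes "\<And>i. c (i + 1) = c i + int (length (w i))"
    and "\<And>i j. j < length (w i) \<Longrightarrow> x (c i + int j) = w i ! j"
  defines "u \<equiv> \<lambda>p n. concat (map (\<lambda>l. w (p + int l)) [0..<n])"
  shows "c (p + int n) = c p + int (length (u p n))"
    and "j < length (u p n) \<Longrightarrow> x (c p + int j) = u p n ! j"
proof (induction n)
  case (Suc n)
  have u: "u p (Suc n) = u p n @ w (p + int n)"
    by (simp add: u_def)
  {
    case 1
    show ?case
      using Suc.IH(1) assms(1)[of "p + int n"] by (simp add: u add.assoc add.commute[of 1])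
  next
    case 2
    show ?case
    proof (cases "j < length (u p n)")
      case True
      then show ?thesis
        using Suc.IH(2) by (simp add: u nth_append)
    next
      case False
      then have "x (c (p + int n) + int (j - length (u p n))) =
          w (p + int n) ! (j - length (u p n))"
        using 2 by (intro assms(2)) (simp add: u)
      then show ?thesis
        using False Suc.IH(1) by (simp add: u nth_append of_nat_diff)
    qed
  }
qed (simp_all add: u_def)

text \<open>Blocks are nonempty, so their starting points advance by at least 1 per block. Enough
  blocks to the left and right of block 0 therefore cover all positions from \<open>-m\<close> to
  \<open>m\<close>.\<close>

lemma window_in_finite_concatenation:
  assumes "x \<in> bi_infinite_concatenations W" "[] \<notin> W"
  obtains u :: "'a list" and a where "u \<in> finite_concatenations W" "m \<le> a" "a + m < length u"
    "\<And>j. j < length u \<Longrightarrow> x (int j - int a) = u ! j"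
proof -
  obtain w :: "int \<Rightarrow> 'a list" and c where "\<forall>i. w i \<in> W \<and> c (i + 1) = c i + int (length (w i)) \<and>
      (\<forall>j < length (w i). x (c i + int j) = w i ! j)"
    using assms(1) unfolding bi_infinite_concatenations_def mem_Collect_eq by (elim exE) (rule that)
  then have w: "\<And>i. w i \<in> W" and c: "\<And>i. c (i + 1) = c i + int (length (w i))"
    and x: "\<And>i j. j < length (w i) \<Longrightarrow> x (c i + int j) = w i ! j"
    by blast+
  have "length (w i) > 0" for i
    using w[of i] assms(2) by auto
  then have "c i + 1 \<le> c (i + 1)" for i
    using c[of i] by (simp add: Suc_le_eq)
  then have grow: "c i + int n \<le> c (i + int n)" for i n
  proof (induction n)
    case (Suc n)
    then show ?case
      using Suc.prems[of "i + int n"] by (simp add: add.assoc add.commute[of 1])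
  qed simp
  \<comment> \<open>Going \<open>k\<close> blocks from block 0 in either direction moves the start
    by at least \<open>k\<close>, which passes \<open>-m\<close> on the left and \<open>m\<close> on
    the right wherever \<open>c 0\<close> lies.\<close>
  define k where "k = m + nat \<bar>c 0\<bar> + 1"
  define p where "p = - int k"
  define u where "u = concat (map (\<lambda>l. w (p + int l)) [0..<2 * k])"
  have cp: "c p \<le> - int m"
    using grow[of p k] by (simp add: p_def k_def)
  have "int m < c (p + int (2 * k))"
    using grow[of 0 k] by (simp add: p_def k_def)
  then have "int m < c p + int (length u)"
    using consecutive_blocks(1)[where c = c and w = w and x = x and p = p and n = "2 * k", OF c x]
    unfolding u_def by linarith
  moreover have "x (c p + int j) = u ! j" if "j < length u" for j
    using consecutive_blocks(2)[where c = c and w = w and x = x and p = p and n = "2 * k", OF c x]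
      that unfolding u_def by blast
  moreover have "u \<in> finite_concatenations W"
    unfolding u_def using w finite_concatenations_incl[of W]
    by (intro finite_concatenations_concat) auto
  ultimately show thesis
    using cp by (intro that[of u "nat (- c p)"]) (auto simp: add.commute)
qed

text \<open>An open set that meets the closure contains a concatenation \<open>y\<close> itself. A
  basic neighbourhood of \<open>y\<close> restricts finitely many coordinates only, and a window of
  \<open>y\<close> consisting of whole words covers them.\<close>

lemma open_contains_finite_concatenation:
  assumes "openin (full_shift A) V" "V \<inter> full_shift A closure_of bi_infinite_concatenations W \<noteq> {}"
    and "[] \<notin> W"
  obtains u a where "u \<in> finite_concatenations W" "a < length u"
    "\<And>z. z \<in> UNIV \<rightarrow>\<^sub>E A \<Longrightarrow> (\<And>j. j < length u \<Longrightarrow> z (int j - int a) = u ! j) \<Longrightarrow> z \<in> V"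
proof -
  obtain y where y: "y \<in> bi_infinite_concatenations W" "y \<in> V"
    using assms(1,2) unfolding in_closure_of disjoint_iff by blast
  obtain B where B: "finite {i. B i \<noteq> A}" "y \<in> Pi\<^sub>E UNIV B" "Pi\<^sub>E UNIV B \<subseteq> V"
    using assms(1) y(2) unfolding full_shift_def openin_product_topology_alt by fastforce
  \<comment> \<open>The restricted coordinates lie between \<open>-m\<close> and \<open>m\<close>;
    the inserted 0 keeps \<open>Max\<close> meaningful if there are none.\<close>
  define m where "m = Max (insert 0 ((\<lambda>i. nat \<bar>i\<bar>) ` {i. B i \<noteq> A}))"
  have m: "\<bar>i\<bar> \<le> int m" if "B i \<noteq> A" for i
  proof -
    have "nat \<bar>i\<bar> \<le> m"
      unfolding m_def using B(1) that by (intro Max_ge) auto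
    then show ?thesis
      by linarith
  qed
  obtain u a where u: "u \<in> finite_concatenations W" "m \<le> a" "a + m < length u"
    "\<And>j. j < length u \<Longrightarrow> y (int j - int a) = u ! j"
    using window_in_finite_concatenation[OF y(1) assms(3)] by blast
  have "z \<in> V" if z: "z \<in> UNIV \<rightarrow>\<^sub>E A" "\<And>j. j < length u \<Longrightarrow> z (int j - int a) = u ! j" for z
  proof -
    have "z i \<in> B i" for i
    proof (cases "B i = A")
      case True
      then show ?thesis
        using z(1) by auto
    next
      case False
      have "nat (i + int a) < length u" "int (nat (i + int a)) - int a = i"
        using m[OF False] u(2,3) by linarith+
      then have "z i = y i"
        using z(2)[of "nat (i + int a)"] u(4)[of "nat (i + int a)"] by simp
      then show ?thesis
        using B(2) by auto
    qed
    then show ?thesis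
      using B(3) by auto
  qed
  then show thesis
    using that[of u a] u by auto
qed

section \<open>Padding to a common length and origin\<close>

lemma open_sets_contain_uniform_concatenations:
  fixes n :: nat
  assumes "\<And>i. i \<in> {1..n} \<Longrightarrow> openin (full_shift A) (V i)"
    and "\<And>i. i \<in> {1..n} \<Longrightarrow> V i \<inter> full_shift A closure_of bi_infinite_concatenations W \<noteq> {}"
    and "[] \<notin> W" "relatively_prime W"
  obtains N a v where "N > 0" "\<And>i. i \<in> {1..n} \<Longrightarrow> v i \<in> finite_concatenations W \<and> length (v i) = N"
    "\<And>i z. i \<in> {1..n} \<Longrightarrow> z \<in> UNIV \<rightarrow>\<^sub>E A \<Longrightarrow>
      (\<forall>j<N. z (int j - int a) = v i ! j) \<Longrightarrow> z \<in> V i"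
proof -
  obtain L where "\<forall>n\<ge>L. \<exists>u\<in>finite_concatenations W. length u = n"
    using finite_concatenations_lengths[OF assms(4)] by blast
  then obtain f where f: "\<And>n. n \<ge> L \<Longrightarrow> f n \<in> finite_concatenations W \<and> length (f n) = n"
    by metis
  have "\<exists>u b. u \<in> finite_concatenations W \<and> b < length u \<and>
      (\<forall>z. z \<in> UNIV \<rightarrow>\<^sub>E A \<longrightarrow> (\<forall>j<length u. z (int j - int b) = u ! j) \<longrightarrow> z \<in> V i)"
    if "i \<in> {1..n}" for i
    by (rule open_contains_finite_concatenation[OF assms(1)[OF that] assms(2)[OF that] assms(3)])
      blast
  then obtain u b where u: "\<And>i. i \<in> {1..n} \<Longrightarrow> u i \<in> finite_concatenations W"
    and b: "\<And>i. i \<in> {1..n} \<Longrightarrow> b i < length (u i)"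
    and V: "\<And>i z. i \<in> {1..n} \<Longrightarrow> z \<in> UNIV \<rightarrow>\<^sub>E A \<Longrightarrow>
      (\<forall>j<length (u i). z (int j - int (b i)) = u i ! j) \<Longrightarrow> z \<in> V i"
    by metis
  define M where "M = (\<Sum>i\<in>{1..n}. length (u i))"
  have M: "length (u i) \<le> M" if "i \<in> {1..n}" for i
    unfolding M_def using that by (intro member_le_sum) auto
  \<comment> \<open>As \<open>b i < length (u i) \<le> M\<close>, these values of \<open>a\<close>
    and \<open>N\<close> leave at least \<open>L\<close> letters for the padding on each side of
    every \<open>u i\<close>, so \<open>f\<close> supplies padding of the exact length. The summand
    1 makes \<open>N\<close> positive even when \<open>n = 0\<close>.\<close>
  define a where "a = L + M"
  define N where "N = a + M + L + 1"
  \<comment> \<open>A prefix of this length moves the origin from position \<open>b i\<close> of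
    \<open>u i\<close> to position \<open>a\<close> of \<open>v i\<close>.\<close>
  define pre where "pre i = f (a - b i)" for i
  define v where "v i = pre i @ u i @ f (N - (a - b i) - length (u i))" for i
  have pre: "pre i \<in> finite_concatenations W" "length (pre i) + b i = a"
    and v: "v i \<in> finite_concatenations W" "length (v i) = N" if i: "i \<in> {1..n}" for i
  proof -
    have *: "a - b i \<ge> L" "N - (a - b i) - length (u i) \<ge> L"
      using b[OF i] M[OF i] by (auto simp: a_def N_def)
    then show "pre i \<in> finite_concatenations W" "length (pre i) + b i = a"
      using f[of "a - b i"] b[OF i] M[OF i] by (auto simp: pre_def a_def)
    with f[OF *(2)] u[OF i] show "v i \<in> finite_concatenations W"
      unfolding v_def by (intro finite_concatenations_append) auto
    show "length (v i) = N"
      using f[OF *(1)] f[OF *(2)] M[OF i] by (simp add: v_def pre_def N_def)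
  qed
  have "z \<in> V i" if i: "i \<in> {1..n}" and z: "z \<in> UNIV \<rightarrow>\<^sub>E A" "\<And>j. j < N \<Longrightarrow> z (int j - int a) = v i ! j"
    for i z
  proof (rule V[OF i z(1)], intro allI impI)
    fix j assume j: "j < length (u i)"
    have "length (pre i) + j < N"
      using v(2)[OF i] j by (simp add: v_def)
    then have "z (int (length (pre i) + j) - int a) = v i ! (length (pre i) + j)"
      by (rule z(2))
    also have "\<dots> = u i ! j"
      using j by (simp add: v_def nth_append)
    also have "int (length (pre i) + j) - int a = int j - int (b i)"
      using pre(2)[OF i] by linarith
    finally show "z (int j - int (b i)) = u i ! j" .
  qed
  then show thesis
    using v by (intro that[of N v a]) (auto simp: N_def)
qed

section \<open>Iterates of the shift and the prescribed itinerary\<close>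

lemma shift_funpow: "(shift ^^ m) x = (\<lambda>i. x (i + int m))"
  by (induction m) (auto simp: shift_def algebra_simps)

lemma shift_funpow_in:
  assumes "shift ` X = X" "x \<in> X"
  shows "(shift ^^ m) x \<in> X"
  using assms by (induction m) auto

theorem theorem3p2:
  fixes A :: "'a set" and X :: "(int \<Rightarrow> 'a) set"
  assumes "finite A"
    and "coded_system A X"
    and "\<exists>W. is_generator A X W \<and> relatively_prime W"
  shows "strong_property_P (subtopology (full_shift A) X) shift"
  unfolding strong_property_P_def
proof (intro allI impI)
  fix n :: nat and U :: "nat \<Rightarrow> (int \<Rightarrow> 'a) set"
  assume U: "\<forall>i\<in>{1..n}. openin (subtopology (full_shift A) X) (U i) \<and> U i \<noteq> {}"
  obtain W where W: "W \<subseteq> lists A" "[] \<notin> W" "relatively_prime W"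
    and X: "X = full_shift A closure_of bi_infinite_concatenations W"
    using assms(3) by (auto simp: is_generator_def)
  have inv: "shift ` X = X"
    using assms(2) by (simp add: coded_system_def subshift_def)
  have XA: "X \<subseteq> UNIV \<rightarrow>\<^sub>E A"
    unfolding X topspace_full_shift[symmetric] by (rule closure_of_subset_topspace)
  obtain V where V: "\<And>i. i \<in> {1..n} \<Longrightarrow> openin (full_shift A) (V i)"
    and UV: "\<And>i. i \<in> {1..n} \<Longrightarrow> U i = V i \<inter> X"
    using U unfolding openin_subtopology by metis
  have ne: "V i \<inter> full_shift A closure_of bi_infinite_concatenations W \<noteq> {}" if "i \<in> {1..n}" for i
    using U UV that X by auto
  \<comment> \<open>These depend on the open sets alone and are fixed before \<open>k\<close> and
    \<open>s\<close>, so one \<open>N\<close> serves all itineraries.\<close>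
  obtain N a v where N: "N > 0"
    and v: "\<And>i. i \<in> {1..n} \<Longrightarrow> v i \<in> finite_concatenations W \<and> length (v i) = N"
    and V': "\<And>i z. i \<in> {1..n} \<Longrightarrow> z \<in> UNIV \<rightarrow>\<^sub>E A \<Longrightarrow>
      (\<forall>j<N. z (int j - int a) = v i ! j) \<Longrightarrow> z \<in> V i"
    by (rule open_sets_contain_uniform_concatenations[where V = V and n = n, OF _ _ W(2,3)])
      (erule V, erule ne, (rule that; blast))
  have "\<exists>x\<in>X. \<forall>j\<in>{1..k}. (shift ^^ ((j - 1) * N)) x \<in> U (s j)"
    if k: "k \<ge> 2" and s: "s \<in> {1..k} \<rightarrow> {1..n}" for k s
  proof -
    have s': "s (Suc l) \<in> {1..n}" if "l < k" for l
      using s that by (auto simp: Pi_iff)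
    \<comment> \<open>Blocks are counted from 0 and the entries of \<open>s\<close> from 1, hence
      \<open>Suc l\<close>.\<close>
    define u where "u = concat (map (\<lambda>l. v (s (Suc l))) [0..<k])"
    have len: "length u = k * N"
      and nth: "\<And>l j. l < k \<Longrightarrow> j < N \<Longrightarrow> u ! (l * N + j) = v (s (Suc l)) ! j"
      unfolding u_def using nth_concat_uniform[of k "\<lambda>l. v (s (Suc l))" N] v s' by blast+
    have "u \<noteq> []"
      using len k N by (metis length_0_conv mult_is_0 not_gr_zero not_numeral_le_zero)
    moreover have "u \<in> finite_concatenations W"
      unfolding u_def using v s' by (intro finite_concatenations_concat) auto
    ultimately have u: "u \<in> finite_concatenations W" "u \<noteq> []"
      by simp_all
    \<comment> \<open>The origin sits at position \<open>a\<close> of the first block, so after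
      \<open>l * N\<close> shifts it sits at position \<open>a\<close> of block
      \<open>l\<close>.\<close>
    define x where "x t = u ! nat ((t + int a) mod int (length u))" for t
    have x: "x \<in> bi_infinite_concatenations W"
      unfolding x_def using periodic_in_bi_infinite_concatenations[OF u] .
    have "x t \<in> A" for t
    proof -
      have "nat ((t + int a) mod int (length u)) < length u"
        using u(2) by (simp add: nat_less_iff)
      then have "x t \<in> set u"
        unfolding x_def by (rule nth_mem)
      then show ?thesis
        using finite_concatenations_subset_lists[OF W(1)] u(1) by auto
    qed
    then have "x \<in> X"
      using x closure_of_subset_Int[of "full_shift A" "bi_infinite_concatenations W"]
      by (auto simp: X topspace_full_shift)
    moreover have "(shift ^^ ((j - 1) * N)) x \<in> U (s j)" if "j \<in> {1..k}" for j
    proof -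
      obtain l where l: "j = Suc l" "l < k"
        using \<open>j \<in> {1..k}\<close> by (cases j) auto
      let ?z = "(shift ^^ (l * N)) x"
      have z: "?z \<in> X"
        using shift_funpow_in[OF inv \<open>x \<in> X\<close>] .
      have "?z (int i - int a) = v (s (Suc l)) ! i" if "i < N" for i
      proof -
        \<comment> \<open>Block \<open>l\<close> ends within the same copy of \<open>u\<close>, so
          the reduction modulo \<open>length u\<close> does not wrap around.\<close>
        have "Suc l * N \<le> k * N"
          using l(2) by (intro mult_le_mono1) simp
        then have "l * N + i < length u"
          using that len by simp
        then have "int (l * N + i) mod int (length u) = int (l * N + i)"
          by (simp only: zmod_int[symmetric] mod_less)
        moreover have "int i - int a + int (l * N) + int a = int (l * N + i)"
          by simp
        ultimately have
          "(int i - int a + int (l * N) + int a) mod int (length u) = int (l * N + i)"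
          by (simp only:)
        then show ?thesis
          using nth[OF l(2) that] by (simp only: shift_funpow x_def nat_int)
      qed
      \<comment> \<open>Agreement with the padded word gives membership in \<open>V\<close>;
        together with the invariance of \<open>X\<close> this gives membership in
        \<open>U\<close>.\<close>
      then have "?z \<in> V (s (Suc l))"
        using V'[OF s'[OF l(2)]] z XA by blast
      then show ?thesis
        using z UV s' l by simp
    qed
    ultimately show ?thesis
      by blast
  qed
  moreover have "topspace (subtopology (full_shift A) X) = X"
    using XA by (auto simp: topspace_full_shift)
  ultimately show "\<exists>N>0. \<forall>k\<ge>2. \<forall>s\<in>{1..k} \<rightarrow> {1..n}.
      \<exists>x\<in>topspace (subtopology (full_shift A) X). \<forall>j\<in>{1..k}. (shift ^^ ((j - 1) * N)) x \<in> U (s j)"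
    using N by (intro exI[of _ N]) simp
qed

end
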